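(* Let $H$ be a complex Hilbert space with $\dim(H)\ge 2$, let $\omega\in\mathbb{T}\setminus\{1\}$ and let $\Theta=\{\theta_j\}_{j\in\mathbb{N}}\subseteq\mathbb{T}$ be defined by $\theta_j=\omega^j$. Let $\mathbf{G}\subseteq H$ be non-empty. Then $\mathbf{G}$ fails $\Theta$-PR if and only if there exist a cover $\{\mathbf{G}_j\}_{j\in\mathbb{N}}$ of $\mathbf{G}$ and a sequence $\{x_j\}_{j\in\mathbb{N}}\subseteq H$ satisfying: 1. $0\neq x_j\in\mathbf{G}_j^\perp$ for every $j\in\mathbb{N}$; 2. $x_1$ and $x_2$ are linearly independent; 3. for every $j\ge 3$, $x_j=(1+\omega)x_{j-1}-\omega x_{j-2}$.
   Context: $\mathbb{T}=\{z\in\mathbb{C}:|z|=1\}$ and $\mathbb{N}=\{1,2,3,\dots\}$. The inner product $\langle\cdot,\cdot\rangle$ is linear in the first and conjugate linear in the second argument. For $\Theta\subseteq\mathbb{T}$, a set $\mathbf{G}\subseteq H$ does $\Theta$-PR (in $H$) if for all $f,h\in H$ the following holds: if for every $g\in\mathbf{G}$ there exists $\theta_g\in\Theta$ with $\langle f,g\rangle=\theta_g\langle h,g\rangle$, then $f=\theta h$ for some $\theta\in\Theta$. $\mathbf{G}$ fails $\Theta$-PR if it does not do $\Theta$-PR. $\{\mathbf{G}_j\}_{j\in\mathbb{N}}$ is a cover of $\mathbf{G}$ if $\mathbf{G}_j\subseteq\mathbf{G}$ for every $j$ and $\bigcup_{j}\mathbf{G}_j=\mathbf{G}$ (the sets may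 overlap and may be empty). $X^\perp$ denotes the orthogonal complement of $X\subseteq H$. *)

theory Defs
  imports "HOL-Analysis.Analysis"
begin

text \<open>
  The inner product is linear in the first and conjugate linear in the second argument.
  Completeness, norm and topology are those of the superclass \<open>banach\<close>; the last two
  axioms tie the real structure to the complex one.
\<close>

class complex_hilbert_space = banach +
  fixes scaleC :: "complex \<Rightarrow> 'a \<Rightarrow> 'a" (infixr "*\<^sub>C" 75)
    and cinner :: "'a \<Rightarrow> 'a \<Rightarrow> complex"
  assumes scaleC_add_right: "a *\<^sub>C (x + y) = a *\<^sub>C x + a *\<^sub>C y"
    and scaleC_add_left: "(a + b) *\<^sub>C x = a *\<^sub>C x + b *\<^sub>C x"
    and scaleC_scaleC: "a *\<^sub>C (b *\<^sub>C x) = (a * b) *\<^sub>C x"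
    and scaleC_one: "1 *\<^sub>C x = x"
    and cinner_commute: "cinner x y = cnj (cinner y x)"
    and cinner_add_left: "cinner (x + y) z = cinner x z + cinner y z"
    and cinner_scaleC_left: "cinner (a *\<^sub>C x) y = a * cinner x y"
    and cinner_ge_zero: "0 \<le> Re (cinner x x)"
    and cinner_eq_zero_iff: "cinner x x = 0 \<longleftrightarrow> x = 0"
    and scaleR_scaleC: "r *\<^sub>R x = complex_of_real r *\<^sub>C x"
    and norm_eq_sqrt_cinner: "norm x = sqrt (Re (cinner x x))"

global_interpretation complex_vector: vector_space
  "scaleC :: complex \<Rightarrow> 'a \<Rightarrow> 'a::complex_hilbert_space"
  by unfold_locales
    (simp_all add: scaleC_add_right scaleC_add_left scaleC_scaleC scaleC_one)

definition does_PR :: "complex set \<Rightarrow> 'a::complex_hilbert_space set \<Rightarrow> bool" where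
  "does_PR \<Theta> G \<longleftrightarrow>
     (\<forall>f h. (\<forall>g\<in>G. \<exists>\<theta>\<in>\<Theta>. cinner f g = \<theta> * cinner h g) \<longrightarrow> (\<exists>\<theta>\<in>\<Theta>. f = \<theta> *\<^sub>C h))"

abbreviation fails_PR :: "complex set \<Rightarrow> 'a::complex_hilbert_space set \<Rightarrow> bool" where
  "fails_PR \<Theta> G \<equiv> \<not> does_PR \<Theta> G"

text \<open>
  Families indexed by \<open>{1, 2, 3, \<dots>}\<close> are functions on \<open>nat\<close> whose value at \<open>0\<close> is ignored.
\<close>

definition is_cover :: "(nat \<Rightarrow> 'a set) \<Rightarrow> 'a set \<Rightarrow> bool" where
  "is_cover Gs G \<longleftrightarrow> (\<forall>j\<ge>1. Gs j \<subseteq> G) \<and> (\<Union>j\<in>{1..}. Gs j) = G"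

text \<open>
  The library's \<open>orthogonal_comp\<close> is taken with respect to a real inner product.
\<close>

definition orthogonal_complement :: "'a::complex_hilbert_space set \<Rightarrow> 'a set" where
  "orthogonal_complement X = {y. \<forall>x\<in>X. cinner y x = 0}"

text \<open>
  The vectors of a pair are linearly independent as a family, so equal vectors are excluded:
  \<open>independent {u, v}\<close> alone would hold for \<open>u = v \<noteq> 0\<close>.
\<close>

definition lin_indep_pair :: "'a::complex_hilbert_space \<Rightarrow> 'a \<Rightarrow> bool" where
  "lin_indep_pair u v \<longleftrightarrow> u \<noteq> v \<and> complex_vector.independent {u, v}"

text \<open>
  The library's \<open>dim\<close> is \<open>0\<close> on infinite-dimensional spaces, so these are treated separately.
\<close>

definition dim_at_least :: "nat \<Rightarrow> 'a::complex_hilbert_space itself \<Rightarrow> bool" where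
  "dim_at_least n _ \<longleftrightarrow>
     (\<nexists>B. finite B \<and> complex_vector.span B = (UNIV :: 'a set)) \<or>
     n \<le> complex_vector.dim (UNIV :: 'a set)"

end

theory Submission
  imports Defs
begin

text \<open>
  The recurrence has the characteristic roots \<open>1\<close> and \<open>\<omega>\<close>, so its solutions are
  \<open>x\<^sub>j = f - \<omega>\<^sup>j h\<close>, and \<open>x\<^sub>j \<bottom> g\<close> says exactly that \<open>\<langle>f, g\<rangle> = \<omega>\<^sup>j \<langle>h, g\<rangle>\<close>. Since
  \<open>\<omega> \<noteq> \<omega>\<^sup>2\<close>, independence of \<open>x\<^sub>1, x\<^sub>2\<close> amounts to independence of \<open>f, h\<close>. It remains to see
  that a failure of phase retrieval always has an independent witness: if a witness \<open>f, h\<close>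
  is dependent, then \<open>G\<close> is orthogonal to some \<open>v \<noteq> 0\<close>, and \<open>v + \<omega> u, u\<close> is a witness for
  any \<open>u\<close> outside the line spanned by \<open>v\<close>.
\<close>

lemma cinner_zero_left: "cinner 0 (y :: 'a::complex_hilbert_space) = 0"
  using cinner_add_left[of 0 0 y] by simp

lemma cinner_diff_left:
  "cinner (x - y) (z :: 'a::complex_hilbert_space) = cinner x z - cinner y z"
  using cinner_add_left[of "x - y" y z] by simp

lemmas scaleC_simps =
  complex_vector.scale_left_distrib complex_vector.scale_right_distrib
  complex_vector.scale_left_diff_distrib complex_vector.scale_right_diff_distrib

text \<open>This form is asymmetric so that, once \<open>v \<noteq> 0\<close> is known, its negation
  supplies a scalar \<open>c\<close> with \<open>u = c *\<^sub>C v\<close>.\<close>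

lemma lin_indep_pair_iff:
  "lin_indep_pair u v \<longleftrightarrow> v \<noteq> 0 \<and> (\<forall>c. u \<noteq> c *\<^sub>C v)"
  by (auto simp: lin_indep_pair_def complex_vector.independent_insert complex_vector.span_singleton
      complex_vector.dependent_single) (metis scaleC_one)

lemma lin_indep_pair_iff_combination:
  "lin_indep_pair u v \<longleftrightarrow> (\<forall>a b. a *\<^sub>C u + b *\<^sub>C v = 0 \<longrightarrow> a = 0 \<and> b = 0)"
proof
  assume *: "lin_indep_pair u v"
  show "\<forall>a b. a *\<^sub>C u + b *\<^sub>C v = 0 \<longrightarrow> a = 0 \<and> b = 0"
  proof (intro allI impI)
    fix a b assume eq: "a *\<^sub>C u + b *\<^sub>C v = 0"
    have "a = 0"
    proof (rule ccontr)
      assume "a \<noteq> 0"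
      have "a *\<^sub>C u = (- b) *\<^sub>C v"
        using eq by (simp add: eq_neg_iff_add_eq_0)
      then have "u = (inverse a * - b) *\<^sub>C v"
        using \<open>a \<noteq> 0\<close> by (metis complex_vector.scale_scale left_inverse scaleC_one)
      then show False
        using * unfolding lin_indep_pair_iff by blast
    qed
    then show "a = 0 \<and> b = 0"
      using eq * by (auto simp: lin_indep_pair_iff)
  qed
next
  assume *: "\<forall>a b. a *\<^sub>C u + b *\<^sub>C v = 0 \<longrightarrow> a = 0 \<and> b = 0"
  have "v \<noteq> 0"
    using *[rule_format, of 0 1] by auto
  moreover have "u \<noteq> c *\<^sub>C v" for c
    using *[rule_format, of 1 "- c"] by auto
  ultimately show "lin_indep_pair u v"
    by (simp add: lin_indep_pair_iff)
qed

text \<open>The coefficient matrix with rows (1, -p) and (1, -q) has determinant p - q, so it is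
  invertible.\<close>

lemma lin_indep_pair_diff_scaleC_iff:
  assumes "p \<noteq> q"
  shows "lin_indep_pair (f - p *\<^sub>C h) (f - q *\<^sub>C h) \<longleftrightarrow> lin_indep_pair f h"
proof
  assume *: "lin_indep_pair (f - p *\<^sub>C h) (f - q *\<^sub>C h)"
  have "h \<noteq> 0" "f \<noteq> c *\<^sub>C h" for c
  proof -
    show "h \<noteq> 0"
      using * by (auto simp: lin_indep_pair_def)
    show "f \<noteq> c *\<^sub>C h"
    proof
      assume "f = c *\<^sub>C h"
      \<comment> \<open>On the line of \<open>h\<close> the two differences are (c - p) h and (c -
        q) h; cross-multiplying them gives a vanishing combination, whose coefficients are both zero
        only if p = c = q.\<close>
      then have "(c - q) *\<^sub>C (f - p *\<^sub>C h) + (p - c) *\<^sub>C (f - q *\<^sub>C h) = 0"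
        by (simp add: scaleC_simps algebra_simps)
      then have "c - q = 0" "p - c = 0"
        using * unfolding lin_indep_pair_iff_combination by blast+
      then show False
        using assms by simp
    qed
  qed
  then show "lin_indep_pair f h"
    by (simp add: lin_indep_pair_iff)
next
  assume *: "lin_indep_pair f h"
  show "lin_indep_pair (f - p *\<^sub>C h) (f - q *\<^sub>C h)"
    unfolding lin_indep_pair_iff_combination
  proof (intro allI impI)
    fix a b assume "a *\<^sub>C (f - p *\<^sub>C h) + b *\<^sub>C (f - q *\<^sub>C h) = 0"
    then have "(a + b) *\<^sub>C f + (- (a * p + b * q)) *\<^sub>C h = 0"
      by (simp add: scaleC_simps algebra_simps)
    then have "a + b = 0" "- (a * p + b * q) = 0"
      using * unfolding lin_indep_pair_iff_combination by blast+
    then have b: "b = - a" and "a * p + b * q = 0"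
      by (simp_all only: eq_neg_iff_add_eq_0 add.commute neg_equal_0_iff_equal)
    then have "a * (p - q) = 0"
      by (simp add: algebra_simps)
    with b show "a = 0 \<and> b = 0"
      using assms by simp
  qed
qed

lemma dim_at_least_2_not_in_line:
  fixes v :: "'a::complex_hilbert_space"
  assumes "dim_at_least 2 TYPE('a)"
  obtains u where "\<forall>c. u \<noteq> c *\<^sub>C v"
proof -
  have "complex_vector.span {v} \<noteq> UNIV"
  proof
    assume *: "complex_vector.span {v} = UNIV"
    \<comment> \<open>The finite spanning set \<open>{v}\<close> rules out the infinite-dimensional
      alternative in \<open>dim_at_least\<close>.\<close>
    then have "2 \<le> complex_vector.dim (UNIV :: 'a set)"
      using assms unfolding dim_at_least_def by (metis finite.emptyI finite.insertI)
    moreover have "complex_vector.dim (UNIV :: 'a set) \<le> card {v}"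
      using * by (intro complex_vector.dim_le_card) auto
    ultimately show False
      by simp
  qed
  then show thesis
    using that by (auto simp: complex_vector.span_singleton)
qed

lemma fails_PR_iff_independent_witness:
  fixes G :: "'a::complex_hilbert_space set"
  assumes dim: "dim_at_least 2 TYPE('a)" and "\<Theta> \<noteq> {}"
  shows "fails_PR \<Theta> G \<longleftrightarrow>
    (\<exists>f h. lin_indep_pair f h \<and> (\<forall>g\<in>G. \<exists>\<theta>\<in>\<Theta>. cinner f g = \<theta> * cinner h g))"
proof
  assume "fails_PR \<Theta> G"
  then obtain f h where fh: "\<forall>g\<in>G. \<exists>\<theta>\<in>\<Theta>. cinner f g = \<theta> * cinner h g"
    and neq: "\<forall>\<theta>\<in>\<Theta>. f \<noteq> \<theta> *\<^sub>C h"
    unfolding does_PR_def by blast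
  show "\<exists>f h. lin_indep_pair f h \<and> (\<forall>g\<in>G. \<exists>\<theta>\<in>\<Theta>. cinner f g = \<theta> * cinner h g)"
  proof (cases "lin_indep_pair f h")
    case True
    with fh show ?thesis by blast
  next
    case False
    have "\<exists>v. v \<noteq> 0 \<and> (\<forall>g\<in>G. cinner v g = 0)"
    proof (cases "h = 0")
      case True
      \<comment> \<open>Any element of \<open>\<Theta>\<close> turns \<open>neq\<close> into
        \<open>f \<noteq> 0\<close>, so \<open>f\<close> itself can serve as
        \<open>v\<close>.\<close>
      with fh neq assms(2) have "f \<noteq> 0" "\<forall>g\<in>G. cinner f g = 0"
        by (auto simp: cinner_zero_left)
      then show ?thesis by blast
    next
      assume "h \<noteq> 0"
      with False obtain c where c: "f = c *\<^sub>C h"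
        by (auto simp: lin_indep_pair_iff)
      then have "c \<notin> \<Theta>"
        using neq by blast
      \<comment> \<open>Here c \<langle>h, g\<rangle> = \<theta> \<langle>h, g\<rangle> for some
        \<theta> in \<open>\<Theta>\<close>, hence \<theta> \<noteq> c, and this forces \<langle>h,
        g\<rangle> = 0.\<close>
      then have "\<forall>g\<in>G. cinner h g = 0"
        using fh by (auto simp: c cinner_scaleC_left)
      with \<open>h \<noteq> 0\<close> show ?thesis by blast
    qed
    then obtain v where v: "v \<noteq> 0" "\<forall>g\<in>G. cinner v g = 0"
      by blast
    obtain u where "\<forall>c. u \<noteq> c *\<^sub>C v"
      using dim_at_least_2_not_in_line[OF dim] by blast
    with v(1) have uv: "lin_indep_pair u v"
      by (simp add: lin_indep_pair_iff)
    obtain \<theta> where "\<theta> \<in> \<Theta>"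
      using assms(2) by blast
    \<comment> \<open>Adding \<open>v\<close> moves \<theta> u off the line of \<open>u\<close>
      without changing any inner product with \<open>G\<close>.\<close>
    have "lin_indep_pair (v + \<theta> *\<^sub>C u) u"
      unfolding lin_indep_pair_iff_combination
    proof (intro allI impI)
      fix a b assume "a *\<^sub>C (v + \<theta> *\<^sub>C u) + b *\<^sub>C u = 0"
      then have "(a * \<theta> + b) *\<^sub>C u + a *\<^sub>C v = 0"
        by (simp add: scaleC_simps algebra_simps)
      then have "a * \<theta> + b = 0" "a = 0"
        using uv unfolding lin_indep_pair_iff_combination by blast+
      then show "a = 0 \<and> b = 0"
        by simp
    qed
    moreover have "\<forall>g\<in>G. cinner (v + \<theta> *\<^sub>C u) g = \<theta> * cinner u g"
      using v(2) by (simp add: cinner_add_left cinner_scaleC_left)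
    ultimately show ?thesis
      using \<open>\<theta> \<in> \<Theta>\<close> by blast
  qed
next
  assume "\<exists>f h. lin_indep_pair f h \<and> (\<forall>g\<in>G. \<exists>\<theta>\<in>\<Theta>. cinner f g = \<theta> * cinner h g)"
  then show "fails_PR \<Theta> G"
    unfolding does_PR_def lin_indep_pair_iff by blast
qed

text \<open>The characteristic polynomial is (t - 1)(t - \<omega>). Its roots are distinct and
  nonzero, so the values at 1 and 2 can be matched by suitable \<open>f\<close> and
  \<open>h\<close>, and they determine the rest.\<close>

lemma recurrence_iff_closed_form:
  fixes x :: "nat \<Rightarrow> 'a::complex_hilbert_space"
  assumes "\<omega> \<noteq> 0" "\<omega> \<noteq> 1"
  shows "(\<forall>j\<ge>3. x j = (1 + \<omega>) *\<^sub>C x (j - 1) - \<omega> *\<^sub>C x (j - 2)) \<longleftrightarrow>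
    (\<exists>f h. \<forall>j\<ge>1. x j = f - \<omega> ^ j *\<^sub>C h)"
proof -
  have step: "(1 + \<omega>) *\<^sub>C (f - \<omega> ^ (j - 1) *\<^sub>C h) - \<omega> *\<^sub>C (f - \<omega> ^ (j - 2) *\<^sub>C h)
      = f - \<omega> ^ j *\<^sub>C h" if "j \<ge> 3" for j and f h :: 'a
  proof -
    have "j = Suc (j - 1)" "j - 1 = Suc (j - 2)"
      using that by auto
    then have "\<omega> ^ j = \<omega> * \<omega> ^ (j - 1)" "\<omega> ^ (j - 1) = \<omega> * \<omega> ^ (j - 2)"
      by (metis power_Suc)+
    then show ?thesis
      by (simp add: scaleC_simps algebra_simps)
  qed
  show ?thesis
  proof
    assume rec: "\<forall>j\<ge>3. x j = (1 + \<omega>) *\<^sub>C x (j - 1) - \<omega> *\<^sub>C x (j - 2)"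
    \<comment> \<open>\<open>h\<close> and \<open>f\<close> solve x 1 = f - \<omega> h and x 2 = f -
      \<open>\<omega>\<^sup>2\<close> h; subtracting the equations isolates
      \<open>h\<close>.\<close>
    define h where "h = inverse (\<omega> - \<omega>\<^sup>2) *\<^sub>C (x 2 - x 1)"
    define f where "f = x 1 + \<omega> *\<^sub>C h"
    have "\<omega> - \<omega>\<^sup>2 \<noteq> 0"
      using assms by (simp add: power2_eq_square)
    then have "(\<omega> - \<omega>\<^sup>2) *\<^sub>C h = x 2 - x 1"
      by (simp add: h_def)
    then have x2: "x 2 = f - \<omega>\<^sup>2 *\<^sub>C h"
      by (simp add: f_def scaleC_simps algebra_simps)
    have "x j = f - \<omega> ^ j *\<^sub>C h" if "j \<ge> 1" for j
      using that
    proof (induction j rule: less_induct)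
      case (less j)
      consider "j = 1" | "j = 2" | "j \<ge> 3"
        using less.prems by linarith
      then show ?case
      proof cases
        case 3
        then have "x (j - 1) = f - \<omega> ^ (j - 1) *\<^sub>C h" "x (j - 2) = f - \<omega> ^ (j - 2) *\<^sub>C h"
          by (auto intro!: less.IH)
        with 3 rec step show ?thesis
          by metis
      qed (use x2 in \<open>simp_all add: f_def\<close>)
    qed
    then show "\<exists>f h. \<forall>j\<ge>1. x j = f - \<omega> ^ j *\<^sub>C h"
      by blast
  next
    assume "\<exists>f h. \<forall>j\<ge>1. x j = f - \<omega> ^ j *\<^sub>C h"
    then obtain f h where x: "\<And>j. j \<ge> 1 \<Longrightarrow> x j = f - \<omega> ^ j *\<^sub>C h"
      by blast
    show "\<forall>j\<ge>3. x j = (1 + \<omega>) *\<^sub>C x (j - 1) - \<omega> *\<^sub>C x (j - 2)"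
      using step by (simp add: x)
  qed
qed

theorem proposition1p4:
  fixes \<omega> :: complex and \<theta> :: "nat \<Rightarrow> complex" and \<Theta> :: "complex set"
    and G :: "'a::complex_hilbert_space set"
  assumes "dim_at_least 2 TYPE('a)"
    and "\<omega> \<in> sphere 0 1 - {1}"
    and "\<And>j. 1 \<le> j \<Longrightarrow> \<theta> j = \<omega> ^ j"
    and "\<Theta> = \<theta> ` {1..}"
    and "G \<noteq> {}"
  shows "fails_PR \<Theta> G \<longleftrightarrow>
    (\<exists>(Gs :: nat \<Rightarrow> 'a set) (x :: nat \<Rightarrow> 'a).
       is_cover Gs G \<and>
       (\<forall>j\<ge>1. x j \<noteq> 0 \<and> x j \<in> orthogonal_complement (Gs j)) \<and>
       lin_indep_pair (x 1) (x 2) \<and>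
       (\<forall>j\<ge>3. x j = (1 + \<omega>) *\<^sub>C x (j - 1) - \<omega> *\<^sub>C x (j - 2)))"
proof -
  \<comment> \<open>The last fact keeps the exponent 1 so that it fits the closed forms of
    \<open>x 1\<close> and \<open>x 2\<close>.\<close>
  have \<omega>: "\<omega> \<noteq> 0" "\<omega> \<noteq> 1" "\<omega> ^ 1 \<noteq> \<omega> ^ 2"
    using assms(2) by (auto simp: power2_eq_square)
  \<comment> \<open>Quantifying over exponents lets the exponent that works for \<open>g\<close>
    name the piece of the cover containing \<open>g\<close>.\<close>
  have ex_\<Theta>: "(\<exists>t\<in>\<Theta>. P t) \<longleftrightarrow> (\<exists>j\<ge>1. P (\<omega> ^ j))" for P
    using assms(3) by (auto simp: assms(4))
  have "\<Theta> \<noteq> {}"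
    by (simp add: assms(4))
  note witness = fails_PR_iff_independent_witness[OF assms(1) this, unfolded ex_\<Theta>]
  have perp: "cinner (f - \<omega> ^ j *\<^sub>C h) g = 0 \<longleftrightarrow> cinner f g = \<omega> ^ j * cinner h g"
    for f h g :: 'a and j
    by (simp add: cinner_diff_left cinner_scaleC_left)
  show ?thesis
    unfolding witness recurrence_iff_closed_form[OF \<omega>(1,2)]
  proof (intro iffI; elim exE conjE)
    fix f h :: 'a
    assume fh: "lin_indep_pair f h" "\<forall>g\<in>G. \<exists>j\<ge>1. cinner f g = \<omega> ^ j * cinner h g"
    define x where "x j = f - \<omega> ^ j *\<^sub>C h" for j
    \<comment> \<open>This is the largest piece of \<open>G\<close> that \<open>x j\<close> allows;
      the pieces may overlap or be empty.\<close>
    define Gs where "Gs j = {g \<in> G. cinner (x j) g = 0}" for j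
    have "is_cover Gs G"
      using fh(2) by (auto simp: is_cover_def Gs_def x_def perp)
    \<comment> \<open>A zero \<open>x j\<close> would make \<open>f\<close> a multiple of
      \<open>h\<close>.\<close>
    moreover have "\<forall>j\<ge>1. x j \<noteq> 0 \<and> x j \<in> orthogonal_complement (Gs j)"
      using fh(1) by (auto simp: x_def Gs_def orthogonal_complement_def lin_indep_pair_iff)
    moreover have "lin_indep_pair (x 1) (x 2)"
      unfolding x_def lin_indep_pair_diff_scaleC_iff[OF \<omega>(3)] by (rule fh(1))
    moreover have "\<exists>f h. \<forall>j\<ge>1. x j = f - \<omega> ^ j *\<^sub>C h"
      unfolding x_def by blast
    ultimately show "\<exists>Gs x. is_cover Gs G \<and>
        (\<forall>j\<ge>1. x j \<noteq> 0 \<and> x j \<in> orthogonal_complement (Gs j)) \<and>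
        lin_indep_pair (x 1) (x 2) \<and> (\<exists>f h. \<forall>j\<ge>1. x j = f - \<omega> ^ j *\<^sub>C h)"
      by blast
  next
    fix Gs :: "nat \<Rightarrow> 'a set" and x f h
    assume cover: "is_cover Gs G"
      and orth: "\<forall>j\<ge>1. x j \<noteq> 0 \<and> x j \<in> orthogonal_complement (Gs j)"
      and indep: "lin_indep_pair (x 1) (x 2)"
      and x: "\<forall>j\<ge>1. x j = f - \<omega> ^ j *\<^sub>C h"
    have "lin_indep_pair f h"
      using indep x lin_indep_pair_diff_scaleC_iff[OF \<omega>(3), of f h] by simp
    moreover have "\<exists>j\<ge>1. cinner f g = \<omega> ^ j * cinner h g" if "g \<in> G" for g
    proof -
      have "(\<Union>j\<in>{1..}. Gs j) = G"
        using cover by (simp only: is_cover_def)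
      with that obtain j where j: "j \<ge> 1" "g \<in> Gs j"
        by blast
      then have "cinner (x j) g = 0"
        using orth by (auto simp: orthogonal_complement_def)
      then have "cinner f g = \<omega> ^ j * cinner h g"
        using x j(1) by (simp add: perp)
      with j(1) show ?thesis
        by blast
    qed
    ultimately show "\<exists>f h. lin_indep_pair f h \<and>
        (\<forall>g\<in>G. \<exists>j\<ge>1. cinner f g = \<omega> ^ j * cinner h g)"
      by blast
  qed
qed

end
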